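(* Let $\mathcal{H}$ be a real Hilbert space and let $\mathcal{A}:\mathcal{H}\to 2^{\mathcal{H}}$, $\mathcal{Q}:\mathcal{H}\to\mathcal{H}$, $\mathcal{B}:\mathcal{H}\to\mathcal{H}$ satisfy: (1) $\mathcal{A}$ is maximally monotone; (2) $\mathcal{Q}$ is linear, bounded, self-adjoint; (3) $\mathcal{Q}$ is degenerate, i.e. positive semi-definite with $\ker\mathcal{Q}\setminus\{0\}\neq\emptyset$; (4) $\mathrm{ran}\,\mathcal{Q}$ is closed; (5) $\mathcal{B}$ is $\beta^{-1}$-cocoercive with $\beta\in[0,+\infty[$ and $\mathrm{dom}\,\mathcal{B}=\mathcal{H}$; (6) $\mathrm{ran}\,\mathcal{B}\subseteq\mathrm{ran}\,\mathcal{Q}$; (7) $\mathrm{ran}(\mathcal{A}+\mathcal{Q})\supseteq\mathrm{ran}(\mathcal{Q}-\mathcal{B})$; (8) $\mathrm{zer}(\mathcal{A}+\mathcal{B})\neq\emptyset$. Let $\nu\in\,]0,+\infty[$ be a constant with $\|\mathcal{Q}x\|\ge\nu\|x\|$ for all $x\in(\ker\mathcal{Q})^\perp=\mathrm{ran}\,\mathcal{Q}$. Let $x^0\in\mathcal{H}$ and let $\{x^k\}_{k\in\mathbb{N}}$ be generated by $x^{k+1}:=x^k+\gamma(\mathcal{T}x^k-x^k)$ with $\mathcal{T}=(\mathcal{A}+\mathcal{Q})^{-1}(\mathcal{Q}-\mathcal{B})$. If $\nu>\beta/2$ and $\gamma\in\,]0,2-\frac{\beta}{2\nu}[$, then: (i)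 There exists $x^\star\in\mathrm{zer}(\mathcal{A}+\mathcal{B})$ such that $\mathcal{Q}x^k\rightharpoonup\mathcal{Q}x^\star$ (weakly) as $k\to\infty$. (ii) For every $x^\star\in\mathrm{zer}(\mathcal{A}+\mathcal{B})$ and every $k\in\mathbb{N}$, $$\|x^{k+1}-x^k\|_{\mathcal{Q}}\le\frac{1}{\sqrt{k+1}}\sqrt{\frac{2\gamma\nu}{(4-2\gamma)\nu-\beta}}\,\|x^0-x^\star\|_{\mathcal{Q}}.$$
   Context: $\|x\|_{\mathcal{Q}}^2:=\langle\mathcal{Q}x|x\rangle$ (a seminorm when $\mathcal{Q}$ is degenerate). $\mathrm{zer}(\mathcal{A}+\mathcal{B})=\{x:0\in\mathcal{A}x+\mathcal{B}x\}$. $\mathcal{B}$ is $\beta^{-1}$-cocoercive if $\langle x_1-x_2|\mathcal{B}x_1-\mathcal{B}x_2\rangle\ge\beta^{-1}\|\mathcal{B}x_1-\mathcal{B}x_2\|^2$ for all $x_1,x_2$; by convention the case $\beta=0$ means $\mathcal{B}=0$. The operator $\mathcal{T}$ is treated as an everywhere defined operator $\mathcal{H}\to\mathcal{H}$ (condition (7) gives $\mathrm{dom}\,\mathcal{T}=\mathcal{H}$). *)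

theory Defs
  imports "HOL-Analysis.Analysis"
begin

text \<open>A set-valued operator \<open>\<H> \<rightarrow> 2\<^sup>\<H>\<close> is a function \<open>'a \<Rightarrow> 'a set\<close>; its domain is the set
  of points with nonempty value.  Single-valued operators are ordinary functions, so their domain
  is the whole space.\<close>

definition monotone_operator :: "('a::real_inner \<Rightarrow> 'a set) \<Rightarrow> bool" where
  "monotone_operator A \<longleftrightarrow>
     (\<forall>x y. \<forall>u\<in>A x. \<forall>v\<in>A y. 0 \<le> (x - y) \<bullet> (u - v))"

definition maximally_monotone :: "('a::real_inner \<Rightarrow> 'a set) \<Rightarrow> bool" where
  "maximally_monotone A \<longleftrightarrow>
     monotone_operator A \<and>
     (\<forall>A'. monotone_operator A' \<and> (\<forall>x. A x \<subseteq> A' x) \<longrightarrow> A' = A)"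

definition sum_operator :: "('a::plus \<Rightarrow> 'a set) \<Rightarrow> ('a \<Rightarrow> 'a) \<Rightarrow> 'a \<Rightarrow> 'a set" where
  "sum_operator A F x = (\<lambda>a. a + F x) ` A x"

definition inverse_operator :: "('a \<Rightarrow> 'a set) \<Rightarrow> 'a \<Rightarrow> 'a set" where
  "inverse_operator A u = {x. u \<in> A x}"

definition range_operator :: "('a \<Rightarrow> 'a set) \<Rightarrow> 'a set" where
  "range_operator A = (\<Union>x. A x)"

definition zer :: "('a::zero \<Rightarrow> 'a set) \<Rightarrow> 'a set" where
  "zer A = {x. 0 \<in> A x}"

definition ker :: "('a::zero \<Rightarrow> 'a) \<Rightarrow> 'a set" where
  "ker F = {x. F x = 0}"

definition self_adjoint :: "('a::real_inner \<Rightarrow> 'a) \<Rightarrow> bool" where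
  "self_adjoint Q \<longleftrightarrow> (\<forall>x y. Q x \<bullet> y = x \<bullet> Q y)"

definition degenerate :: "('a::real_inner \<Rightarrow> 'a) \<Rightarrow> bool" where
  "degenerate Q \<longleftrightarrow> (\<forall>x. 0 \<le> Q x \<bullet> x) \<and> ker Q - {0} \<noteq> {}"

text \<open>\<open>\<beta>\<^sup>-\<^sup>1\<close>-cocoercivity for \<open>\<beta> \<ge> 0\<close>.  The case \<open>\<beta> = 0\<close> stands for \<open>B = 0\<close>; it must be
  separated here, because \<open>inverse 0 = 0\<close> would turn the inequality into mere monotonicity.\<close>

definition inverse_cocoercive :: "real \<Rightarrow> ('a::real_inner \<Rightarrow> 'a) \<Rightarrow> bool" where
  "inverse_cocoercive \<beta> B \<longleftrightarrow>
     (if \<beta> = 0 then \<forall>x. B x = 0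
      else \<forall>x y. (x - y) \<bullet> (B x - B y) \<ge> inverse \<beta> * (norm (B x - B y))\<^sup>2)"

definition Q_seminorm :: "('a::real_inner \<Rightarrow> 'a) \<Rightarrow> 'a \<Rightarrow> real" where
  "Q_seminorm Q x = sqrt (Q x \<bullet> x)"

text \<open>Weak convergence in a Hilbert space; the functionals \<open>\<lambda>y. y \<bullet> u\<close> are the ones defining
  the weak topology.\<close>

definition weakly_converges_to :: "(nat \<Rightarrow> 'a::real_inner) \<Rightarrow> 'a \<Rightarrow> bool" where
  "weakly_converges_to f l \<longleftrightarrow> (\<forall>u. (\<lambda>k. f k \<bullet> u) \<longlonglongrightarrow> l \<bullet> u)"

text \<open>The operator \<open>(A + Q)\<^sup>-\<^sup>1 (Q - B)\<close>.  As \<open>Q\<close> is degenerate, its values need not be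
  singletons: two elements of the same value may differ by an element of the kernel of \<open>Q\<close>.
  An everywhere defined operator \<open>T\<close> from the space to itself is therefore
  read as one with \<open>T x \<in> forward_backward A Q B x\<close> for all \<open>x\<close>; where the value is a singleton
  this says \<open>forward_backward A Q B x = {T x}\<close>.\<close>

definition forward_backward ::
  "('a::real_inner \<Rightarrow> 'a set) \<Rightarrow> ('a \<Rightarrow> 'a) \<Rightarrow> ('a \<Rightarrow> 'a) \<Rightarrow> 'a \<Rightarrow> 'a set" where
  "forward_backward A Q B x = inverse_operator (sum_operator A Q) (Q x - B x)"

end

theory Submission
  imports Defs
begin

text \<open>Write \<open>N z = Q z \<bullet> z\<close>. On \<open>(ker Q)\<^sup>\<bottom>\<close> the form \<open>N\<close> dominates \<open>\<nu>\<close> times the squared norm, so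
  monotonicity of \<open>A\<close> and cocoercivity of \<open>B\<close> make \<open>T\<close> averaged for the seminorm of \<open>N\<close>. Hence
  \<open>N (x k - s)\<close> decreases for every zero \<open>s\<close>, with a gain proportional to \<open>N (x (k + 1) - x k)\<close>;
  since the latter is itself decreasing, summation gives the rate. For weak convergence, the minimizer
  of \<open>z \<mapsto> limsup N (x k - z)\<close> along any filter finer than \<open>sequentially\<close> is mapped by \<open>T\<close> to a zero
  that is also a minimizer. One and the same zero \<open>s\<close> is therefore a minimizer along all such filters,
  and if \<open>Q (x k - s) \<bullet> u\<close> stayed away from \<open>0\<close> along one of them, moving \<open>s\<close> in the direction \<open>u\<close>
  would lower the limsup.\<close>

section \<open>Minimizers of strongly midpoint-convex functions\<close>

text \<open>The midpoint of two almost minimizing points still has at least the infimum as value, so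
  the gap term makes every minimizing sequence Cauchy, and completeness supplies the minimizer.
  Serves both for projections and for asymptotic centers.\<close>

lemma strongly_midconvex_minimizer:
  fixes \<phi> :: "'a::{real_normed_vector, complete_space} \<Rightarrow> real"
  assumes "closed C" "C \<noteq> {}" "\<kappa> > 0"
    and mid: "\<And>a b. a \<in> C \<Longrightarrow> b \<in> C \<Longrightarrow> (1/2) *\<^sub>R (a + b) \<in> C \<and>
           \<phi> ((1/2) *\<^sub>R (a + b)) \<le> (\<phi> a + \<phi> b) / 2 - \<kappa> * (norm (a - b))\<^sup>2"
    and bdd: "bdd_below (\<phi> ` C)"
    and lsc: "\<And>z c l. (\<And>n::nat. z n \<in> C) \<Longrightarrow> z \<longlonglongrightarrow> c \<Longrightarrow> (\<lambda>n. \<phi> (z n)) \<longlonglongrightarrow> l \<Longrightarrow> \<phi> c \<le> l"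
  obtains c where "c \<in> C" "\<And>z. z \<in> C \<Longrightarrow> \<phi> c \<le> \<phi> z"
proof -
  define m where "m = Inf (\<phi> ` C)"
  have m_le: "m \<le> \<phi> z" if "z \<in> C" for z
    unfolding m_def using that bdd by (intro cInf_lower) auto
  have "\<exists>z\<in>C. \<phi> z < m + 1 / real (Suc n)" for n
  proof -
    have "Inf (\<phi> ` C) < m + 1 / real (Suc n)" by (simp add: m_def)
    then show ?thesis using cInf_less_iff[of "\<phi> ` C"] bdd assms(2) by auto
  qed
  then obtain z where zC: "\<And>n. z n \<in> C" and zm: "\<And>n. \<phi> (z n) < m + 1 / real (Suc n)"
    by metis
  have dist: "\<kappa> * (norm (z i - z j))\<^sup>2 \<le> 1 / real (Suc n)" if "i \<ge> n" "j \<ge> n" for i j n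
  proof -
    have "1 / real (Suc i) \<le> 1 / real (Suc n)" "1 / real (Suc j) \<le> 1 / real (Suc n)"
      using that by (auto simp: field_simps)
    then have "(\<phi> (z i) + \<phi> (z j)) / 2 < m + 1 / real (Suc n)"
      using zm[of i] zm[of j] by argo
    moreover have "m \<le> (\<phi> (z i) + \<phi> (z j)) / 2 - \<kappa> * (norm (z i - z j))\<^sup>2"
      using mid[OF zC zC, of i j] m_le by fastforce
    ultimately show ?thesis by argo
  qed
  have "Cauchy z"
  proof (rule metric_CauchyI)
    fix e :: real assume "e > 0"
    then have "0 < \<kappa> * e\<^sup>2" using assms(3) by simp
    then obtain n where n: "1 / real (Suc n) < \<kappa> * e\<^sup>2"
      using nat_approx_posE by blast
    have "dist (z i) (z j) < e" if "i \<ge> n" "j \<ge> n" for i j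
    proof -
      have "\<kappa> * (norm (z i - z j))\<^sup>2 < \<kappa> * e\<^sup>2" using dist[OF that] n by linarith
      then have "(norm (z i - z j))\<^sup>2 < e\<^sup>2" using assms(3) by simp
      then show ?thesis using \<open>e > 0\<close> by (simp add: dist_norm power_less_imp_less_base)
    qed
    then show "\<exists>M. \<forall>i\<ge>M. \<forall>j\<ge>M. dist (z i) (z j) < e" by blast
  qed
  then obtain c where c: "z \<longlonglongrightarrow> c" using Cauchy_convergent_iff convergent_def by blast
  have "(\<lambda>n. m + 1 / real (Suc n)) \<longlonglongrightarrow> m + 0"
    by (intro tendsto_add tendsto_const LIMSEQ_Suc[OF lim_1_over_n])
  then have "(\<lambda>n. \<phi> (z n)) \<longlonglongrightarrow> m"
    using tendsto_sandwich[of "\<lambda>_. m" "\<lambda>n. \<phi> (z n)" sequentially "\<lambda>n. m + 1 / real (Suc n)" m]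
      m_le[OF zC] less_imp_le[OF zm] by (simp del: of_nat_Suc)
  then have "\<phi> c \<le> m" using lsc[OF zC c] by blast
  moreover have "c \<in> C" using assms(1) zC c closed_sequentially by blast
  ultimately show ?thesis using that m_le order_trans by blast
qed

text \<open>Take \<open>v\<close> nearest to \<open>z\<close> in \<open>V\<close>: by the
  parallelogram law the squared distance is strongly midconvex with constant 1/4, and varying
  \<open>v\<close> inside \<open>V\<close> shows the remainder to be orthogonal.\<close>

lemma orthogonal_decomposition:
  fixes V :: "'a::{real_inner, complete_space} set"
  assumes "closed V" "subspace V"
  obtains v where "v \<in> V" "z - v \<in> V\<^sup>\<bottom>"
proof -
  have par: "(norm (z - (1/2) *\<^sub>R (a + b)))\<^sup>2
      = ((norm (z - a))\<^sup>2 + (norm (z - b))\<^sup>2) / 2 - 1/4 * (norm (a - b))\<^sup>2" for a b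
    by (simp add: power2_norm_eq_inner algebra_simps inner_commute add_divide_distrib diff_divide_distrib)
  obtain v where v: "v \<in> V" "\<And>w. w \<in> V \<Longrightarrow> (norm (z - v))\<^sup>2 \<le> (norm (z - w))\<^sup>2"
  proof (rule strongly_midconvex_minimizer[of V "1/4" "\<lambda>w. (norm (z - w))\<^sup>2"])
    show "V \<noteq> {}" using assms(2) subspace_0 by blast
    show "bdd_below ((\<lambda>w. (norm (z - w))\<^sup>2) ` V)" by (rule bdd_belowI[of _ 0]) auto
    show "(norm (z - c))\<^sup>2 \<le> l"
      if "w \<longlonglongrightarrow> c" "(\<lambda>n. (norm (z - w n))\<^sup>2) \<longlonglongrightarrow> l" for w c and l :: real
    proof -
      have "(\<lambda>n. (norm (z - w n))\<^sup>2) \<longlonglongrightarrow> (norm (z - c))\<^sup>2"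
        by (intro tendsto_intros that)
      then show ?thesis using that(2) LIMSEQ_unique by blast
    qed
    show "(1/2) *\<^sub>R (a + b) \<in> V \<and> (norm (z - (1/2) *\<^sub>R (a + b)))\<^sup>2
        \<le> ((norm (z - a))\<^sup>2 + (norm (z - b))\<^sup>2) / 2 - 1/4 * (norm (a - b))\<^sup>2"
      if "a \<in> V" "b \<in> V" for a b
      using that assms(2) par[of a b] by (auto intro: subspace_scale subspace_add)
  qed (use assms in auto)
  have "w \<bullet> (z - v) = 0" if "w \<in> V" for w
  proof (cases "w = 0")
    case False
    \<comment> \<open>The minimizer of the squared distance from \<open>z\<close> along the line
      \<open>v + t *\<^sub>R w\<close>.\<close>
    define t where "t = (w \<bullet> (z - v)) / (w \<bullet> w)"
    have "(norm (z - v))\<^sup>2 \<le> (norm (z - (v + t *\<^sub>R w)))\<^sup>2"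
      using that v(1) assms(2) by (intro v(2) subspace_add subspace_scale)
    also have "\<dots> = (norm (z - v))\<^sup>2 - 2 * t * (w \<bullet> (z - v)) + t\<^sup>2 * (w \<bullet> w)"
      by (simp only: power2_norm_eq_inner) (simp add: power2_eq_square algebra_simps inner_commute)
    also have "\<dots> = (norm (z - v))\<^sup>2 - (w \<bullet> (z - v))\<^sup>2 / (w \<bullet> w)"
      using False by (simp add: t_def power2_eq_square field_simps)
    finally have "(w \<bullet> (z - v))\<^sup>2 / (w \<bullet> w) \<le> 0" by simp
    then show ?thesis using inner_gt_zero_iff[of w] False by (simp add: pos_divide_le_eq)
  qed simp
  then have "z - v \<in> V\<^sup>\<bottom>" by (simp add: orthogonal_comp_def orthogonal_def)
  then show ?thesis using that v(1) by blast
qed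

section \<open>Upper limits of real functions along a filter\<close>

text \<open>A junk value unless \<open>f\<close> is eventually bounded above and not tending to \<open>- \<infinity>\<close>.\<close>

definition real_limsup :: "'b filter \<Rightarrow> ('b \<Rightarrow> real) \<Rightarrow> real" where
  "real_limsup F f = Inf {c. eventually (\<lambda>k. f k \<le> c) F}"

lemma real_limsup_bdd_below:
  assumes "F \<noteq> bot" "\<And>k. l \<le> f k"
  shows "bdd_below {c::real. eventually (\<lambda>k. f k \<le> c) F}"
proof (rule bdd_belowI[of _ l])
  fix c assume "c \<in> {c. eventually (\<lambda>k. f k \<le> c) F}"
  then obtain k where "f k \<le> c" using eventually_happens assms(1) by fastforce
  then show "l \<le> c" using assms(2)[of k] by linarith
qed

lemma real_limsup_le:
  assumes "F \<noteq> bot" "\<And>k. l \<le> f k" "eventually (\<lambda>k. f k \<le> c) F"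
  shows "real_limsup F f \<le> c"
  unfolding real_limsup_def
  using real_limsup_bdd_below[of F l f, OF assms(1,2)] assms(3) by (intro cInf_lower) auto

lemma real_limsup_ge:
  assumes "F \<noteq> bot" "\<And>k. l \<le> f k" "eventually (\<lambda>k. f k \<le> c) F"
  shows "l \<le> real_limsup F f"
  unfolding real_limsup_def
proof (rule cInf_greatest)
  fix d assume "d \<in> {c. eventually (\<lambda>k. f k \<le> c) F}"
  then obtain k where "f k \<le> d" using eventually_happens assms(1) by fastforce
  then show "l \<le> d" using assms(2)[of k] by linarith
qed (use assms in auto)

lemma eventually_le_real_limsup:
  assumes "F \<noteq> bot" "\<And>k. l \<le> f k" "eventually (\<lambda>k. f k \<le> c) F" "\<delta> > 0"
  shows "eventually (\<lambda>k. f k \<le> real_limsup F f + \<delta>) F"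
proof -
  have "Inf {c. eventually (\<lambda>k. f k \<le> c) F} < real_limsup F f + \<delta>"
    using assms(4) by (simp add: real_limsup_def)
  then obtain d where "d < real_limsup F f + \<delta>" "eventually (\<lambda>k. f k \<le> d) F"
    using cInf_less_iff[OF _ real_limsup_bdd_below[of F l f, OF assms(1,2)]] assms(3) by blast
  then show ?thesis by (auto elim: eventually_mono)
qed

lemma real_limsup_eq_lim:
  assumes "F \<noteq> bot" "\<And>k. l \<le> f k" "(f \<longlongrightarrow> a) F"
  shows "real_limsup F f = a"
proof (rule antisym)
  have ev: "eventually (\<lambda>k. f k \<le> a + e) F" if "e > 0" for e
    using order_tendstoD(2)[OF assms(3), of "a + e"] that by (auto elim: eventually_mono)
  show "real_limsup F f \<le> a"
    by (rule field_le_epsilon, rule real_limsup_le[of F l f, OF assms(1,2) ev])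
  show "a \<le> real_limsup F f"
  proof (rule field_le_epsilon)
    fix e :: real assume "e > 0"
    then show "a \<le> real_limsup F f + e"
      by (intro tendsto_upperbound[OF assms(3) _ assms(1)]
          eventually_le_real_limsup[of F l f, OF assms(1,2) ev[OF zero_less_one]])
  qed
qed

text \<open>Subadditivity and positive homogeneity of the upper limit in one inequality; a call that
  concerns one function only gives the other the weight 0.\<close>

lemma real_limsup_le_combination:
  assumes F: "F \<noteq> bot" and f: "\<And>k. l \<le> f k"
    and g: "\<And>k. l \<le> g k" "eventually (\<lambda>k. g k \<le> c) F"
    and h: "\<And>k. l \<le> h k" "eventually (\<lambda>k. h k \<le> d) F"
    and "0 \<le> p" "0 \<le> q"
    and le: "eventually (\<lambda>k. f k \<le> p * g k + q * h k + r) F"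
  shows "real_limsup F f \<le> p * real_limsup F g + q * real_limsup F h + r"
proof (rule field_le_epsilon)
  fix e :: real assume e: "e > 0"
  \<comment> \<open>The slack is spent \<open>p + q\<close> times in total; the extra 1 covers
    \<open>p = q = 0\<close>.\<close>
  define \<delta> where "\<delta> = e / (p + q + 1)"
  have \<delta>: "\<delta> > 0" "(p + q) * \<delta> \<le> e"
    using e assms(7,8) by (auto simp: \<delta>_def field_simps)
  have "eventually (\<lambda>k. f k \<le> p * real_limsup F g + q * real_limsup F h + r + e) F"
    using le eventually_le_real_limsup[of F l g, OF F g \<delta>(1)]
      eventually_le_real_limsup[of F l h, OF F h \<delta>(1)]
  proof eventually_elim
    case (elim k)
    have "p * g k \<le> p * (real_limsup F g + \<delta>)" "q * h k \<le> q * (real_limsup F h + \<delta>)"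
      using elim assms(7,8) by (auto intro: mult_left_mono)
    then show ?case using elim(1) \<delta>(2) by (simp add: algebra_simps)
  qed
  then show "real_limsup F f \<le> p * real_limsup F g + q * real_limsup F h + r + e"
    by (rule real_limsup_le[of F l f, OF F f])
qed

text \<open>Disposes of the factor \<open>1 + \<epsilon>\<close> that \<open>N_add_le\<close>
  introduces, by letting \<epsilon> tend to 0 from the right.\<close>

lemma le_if_le_scaled:
  fixes a b :: real
  assumes "\<And>\<epsilon>. \<epsilon> > 0 \<Longrightarrow> a \<le> (1 + \<epsilon>) * b"
  shows "a \<le> b"
proof (rule tendsto_lowerbound)
  have "((\<lambda>\<epsilon>. (1 + \<epsilon>) * b) \<longlongrightarrow> (1 + 0) * b) (at_right 0)"
    by (intro tendsto_intros)
  then show "((\<lambda>\<epsilon>. (1 + \<epsilon>) * b) \<longlongrightarrow> b) (at_right 0)" by simp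
  show "eventually (\<lambda>\<epsilon>. a \<le> (1 + \<epsilon>) * b) (at_right 0)"
    using eventually_at_right_less[of 0] by eventually_elim (rule assms)
qed simp

section \<open>Degenerate preconditioners\<close>

text \<open>Positivity of the form at \<open>z - t *\<^sub>R S z\<close> bounds \<open>S z\<close>.
  The subspace \<open>V\<close> is singled out because \<open>S\<close> will also be
  \<open>Q - m\<close>, whose positivity is known only on
  \<open>(ker Q)\<^sup>\<bottom>\<close>.\<close>

lemma norm_image_sq_le_form:
  fixes S :: "'a::real_inner \<Rightarrow> 'a"
  assumes "linear S" "self_adjoint S" "subspace V" "z \<in> V" "S z \<in> V"
    and pos: "\<And>w. w \<in> V \<Longrightarrow> 0 \<le> S w \<bullet> w"
    and "L > 0" "\<And>w. S w \<bullet> w \<le> L * (norm w)\<^sup>2"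
  shows "(norm (S z))\<^sup>2 \<le> L * (S z \<bullet> z)"
proof -
  interpret linear S by fact
  \<comment> \<open>Minimizes \<open>L * t\<^sup>2 - 2 * t\<close>, the coefficient of
    \<open>(norm (S z))\<^sup>2\<close> once the form at \<open>S z\<close> is bounded through
    \<open>L\<close>.\<close>
  define t where "t = 1 / L"
  have "0 \<le> S (z - t *\<^sub>R S z) \<bullet> (z - t *\<^sub>R S z)"
    using assms by (intro pos subspace_diff subspace_scale)
  also have "\<dots> = S z \<bullet> z - 2 * t * (norm (S z))\<^sup>2 + t * (t * (S (S z) \<bullet> S z))"
    using assms(2) by (simp add: diff scale self_adjoint_def power2_norm_eq_inner algebra_simps)
  also have "\<dots> \<le> S z \<bullet> z - 2 * t * (norm (S z))\<^sup>2 + t * (t * (L * (norm (S z))\<^sup>2))"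
    using assms by (intro add_left_mono mult_left_mono) (auto simp: t_def)
  also have "\<dots> = S z \<bullet> z - (norm (S z))\<^sup>2 / L"
    using assms by (simp add: t_def)
  finally show ?thesis using assms by (simp add: field_simps)
qed

section \<open>Geometry of the seminorm induced by \<open>Q\<close>\<close>

locale degenerate_preconditioner =
  fixes Q :: "'a::{real_inner, complete_space} \<Rightarrow> 'a" and \<nu> :: real
  assumes bl: "bounded_linear Q" and sa: "self_adjoint Q"
    and psd: "\<And>z. 0 \<le> Q z \<bullet> z"
    and \<nu>: "0 < \<nu>"
    and \<nu>_le: "\<And>z. z \<in> (ker Q)\<^sup>\<bottom> \<Longrightarrow> \<nu> * norm z \<le> norm (Q z)"
begin

sublocale bounded_linear Q by (rule bl)

abbreviation N :: "'a \<Rightarrow> real" where "N z \<equiv> Q z \<bullet> z"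

lemma sym: "Q a \<bullet> b = Q b \<bullet> a"
  using sa by (simp add: self_adjoint_def inner_commute)

lemma N_add: "N (a + b) = N a + 2 * (Q a \<bullet> b) + N b"
  using sym[of a b] by (simp add: add inner_add_left inner_add_right)

lemma N_diff: "N (a - b) = N a - 2 * (Q a \<bullet> b) + N b"
  using sym[of a b] by (simp add: diff inner_diff_left inner_diff_right)

lemma N_scale: "N (t *\<^sub>R a) = t\<^sup>2 * N a"
  by (simp add: scale power2_eq_square)

lemma N_minus_commute: "N (a - b) = N (b - a)"
  using N_scale[of "-1" "a - b"] by simp

text \<open>Weighted triangle inequality, from positivity at
  \<open>\<epsilon> *\<^sub>R a - b\<close>. The weight of \<open>a\<close> comes as close to 1 as
  desired at the expense of \<open>b\<close>, which in the limit arguments below tends to 0.\<close>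

lemma N_add_le:
  assumes "\<epsilon> > 0"
  shows "N (a + b) \<le> (1 + \<epsilon>) * N a + (1 + 1 / \<epsilon>) * N b"
proof -
  have "0 \<le> N (\<epsilon> *\<^sub>R a - b)" by (rule psd)
  also have "\<dots> = \<epsilon>\<^sup>2 * N a - 2 * \<epsilon> * (Q a \<bullet> b) + N b"
    by (simp add: N_diff N_scale) (simp add: scale power2_eq_square)
  finally have "2 * (Q a \<bullet> b) \<le> \<epsilon> * N a + N b / \<epsilon>"
    using assms by (simp add: field_simps power2_eq_square)
  then show ?thesis unfolding N_add by (simp add: distrib_right)
qed

lemma form_le_norm_sq:
  obtains L where "L > 0" "\<And>w. N w \<le> L * (norm w)\<^sup>2"
proof -
  obtain L where L: "L > 0" "\<And>w. norm (Q w) \<le> norm w * L" using pos_bounded by blast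
  have "N w \<le> L * (norm w)\<^sup>2" for w
  proof -
    have "N w \<le> norm (Q w) * norm w" by (rule norm_cauchy_schwarz)
    also have "\<dots> \<le> (norm w * L) * norm w" using L by (intro mult_right_mono) auto
    finally show ?thesis by (simp add: power2_eq_square algebra_simps)
  qed
  then show ?thesis using that L by blast
qed

text \<open>\<open>norm_image_sq_le_form\<close> on the whole space bounds \<open>norm (Q z)\<close>
  by a multiple of the seminorm.\<close>

lemma N_eq_0D: "N z = 0 \<Longrightarrow> Q z = 0"
proof -
  assume z: "N z = 0"
  obtain L where L: "L > 0" "\<And>w. N w \<le> L * (norm w)\<^sup>2" using form_le_norm_sq by blast
  have "(norm (Q z))\<^sup>2 \<le> L * N z"
    by (rule norm_image_sq_le_form[where V = UNIV]) (use L psd sa linear_axioms in auto)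
  then show ?thesis using z by simp
qed

text \<open>By symmetry \<open>N a = Q b \<bullet> a = Q a \<bullet> b = N b\<close>; the seminorm
  lives on the quotient by \<open>ker Q\<close>.\<close>

lemma N_cong: "Q a = Q b \<Longrightarrow> N a = N b"
  by (metis sym)

lemma range_ker_comp: "Q z \<in> (ker Q)\<^sup>\<bottom>"
  using sa by (auto simp: orthogonal_comp_def orthogonal_def self_adjoint_def ker_def)
    (metis inner_zero_left)

text \<open>Subtracting the projection onto the closed kernel selects, in each class modulo
  \<open>ker Q\<close>, the representative to which \<open>\<nu>_le\<close> applies.\<close>

lemma ker_decomposition:
  obtains p where "p \<in> (ker Q)\<^sup>\<bottom>" "Q p = Q z"
proof -
  have "closed (ker Q)"
    unfolding ker_def by (intro closed_Collect_eq continuous_on continuous_on_const continuous_on_id)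
  moreover have "subspace (ker Q)" by (auto simp: subspace_def ker_def add scale zero)
  ultimately obtain v where "v \<in> ker Q" "z - v \<in> (ker Q)\<^sup>\<bottom>"
    using orthogonal_decomposition by blast
  then show ?thesis using that by (auto simp: ker_def diff)
qed

text \<open>With \<open>m\<close> the infimum of the quadratic form on the unit sphere of \<open>(ker Q)\<^sup>\<bottom>\<close>, the operator
  \<open>Q - m\<close> is positive there, so it nearly annihilates almost minimizing unit vectors \<open>z\<close>; hence
  \<open>\<nu> \<le> norm (Q z)\<close> is close to \<open>m\<close>.\<close>

lemma coercive:
  assumes "z \<in> (ker Q)\<^sup>\<bottom>"
  shows "\<nu> * (norm z)\<^sup>2 \<le> N z"
proof (cases "z = 0")
  case False
  let ?V = "(ker Q)\<^sup>\<bottom>"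
  have V: "subspace ?V" by (rule subspace_orthogonal_comp)
  define U where "U = {z \<in> ?V. norm z = 1}"
  define m where "m = Inf (N ` U)"
  have U: "sgn z \<in> U" if "z \<in> ?V" "z \<noteq> 0" for z
    using that V by (auto simp: U_def norm_sgn sgn_div_norm subspace_scale)
  have bdd: "bdd_below (N ` U)" using psd by (intro bdd_belowI[of _ 0]) auto
  have m0: "0 \<le> m"
    unfolding m_def using U[OF assms False] psd by (intro cInf_greatest) auto
  have m_le: "m * (norm w)\<^sup>2 \<le> N w" if "w \<in> ?V" for w
  proof (cases "w = 0")
    case False
    have "m \<le> N (sgn w)" unfolding m_def using U[OF that False] bdd by (intro cInf_lower) auto
    also have "\<dots> = N w / (norm w)\<^sup>2"
      by (simp add: sgn_div_norm scale power2_eq_square field_simps)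
    finally show ?thesis using False by (simp add: field_simps)
  qed (simp add: zero)
  obtain L where L: "L > 0" "\<And>w. N w \<le> L * (norm w)\<^sup>2" using form_le_norm_sq by blast
  define S where "S w = Q w - m *\<^sub>R w" for w
  have S_form: "S w \<bullet> w = N w - m * (norm w)\<^sup>2" for w
    by (simp add: S_def inner_diff_left power2_norm_eq_inner)
  have near: "\<nu> \<le> m + sqrt (L * (N w - m))" if "w \<in> U" for w
  proof -
    have w: "w \<in> ?V" "norm w = 1" using that by (auto simp: U_def)
    have "(norm (S w))\<^sup>2 \<le> L * (S w \<bullet> w)"
    proof (rule norm_image_sq_le_form[where V = ?V])
      show "linear S" unfolding S_def
        by (intro linear_compose_sub linear_axioms linear_scale_self)
      show "self_adjoint S" using sa
        by (simp add: self_adjoint_def S_def inner_diff_left inner_diff_right)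
      show "S w \<in> ?V" unfolding S_def
        using V w range_ker_comp by (intro subspace_diff subspace_scale)
      \<comment> \<open>Since \<open>m\<close> is nonnegative, subtracting it only lowers the form,
        so the bound \<open>L\<close> for \<open>Q\<close> still serves.\<close>
      show "S y \<bullet> y \<le> L * (norm y)\<^sup>2" for y
        using L(2)[of y] mult_nonneg_nonneg[OF m0 zero_le_power2[of "norm y"]]
        unfolding S_form by linarith
    qed (use V w m_le L in \<open>auto simp: S_form\<close>)
    then have "norm (S w) \<le> sqrt (L * (N w - m))"
      using w by (simp add: S_form real_le_rsqrt)
    moreover have "norm (Q w) \<le> norm (S w) + norm (m *\<^sub>R w)"
      using norm_triangle_ineq[of "S w" "m *\<^sub>R w"] by (simp add: S_def)
    ultimately show ?thesis using \<nu>_le[OF w(1)] w m0 by simp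
  qed
  have "\<nu> \<le> m"
  proof (rule ccontr)
    assume "\<not> \<nu> \<le> m"
    \<comment> \<open>The excess over \<open>m\<close> is chosen so that \<open>near\<close> would
      read \<open>\<nu> < \<nu>\<close>.\<close>
    then have "0 < (\<nu> - m)\<^sup>2 / L" using L by simp
    then have "Inf (N ` U) < m + (\<nu> - m)\<^sup>2 / L" by (simp add: m_def)
    then obtain w where w: "w \<in> U" "N w < m + (\<nu> - m)\<^sup>2 / L"
      using cInf_less_iff[OF _ bdd] U[OF assms False] by blast
    then have "L * (N w - m) < (\<nu> - m)\<^sup>2" using L by (simp add: field_simps)
    then have "sqrt (L * (N w - m)) < \<nu> - m"
      using \<open>\<not> \<nu> \<le> m\<close> by (intro real_less_lsqrt) auto
    then show False using near[OF w(1)] by linarith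
  qed
  then have "\<nu> * (norm z)\<^sup>2 \<le> m * (norm z)\<^sup>2" by (intro mult_right_mono) auto
  then show ?thesis using m_le[OF assms] by linarith
qed (simp add: zero)

text \<open>Pairing with the range of \<open>Q\<close> sees \<open>d\<close> only modulo
  \<open>ker Q\<close>, so \<open>d\<close> may be traded for its representative \<open>p\<close>,
  whose norm \<open>coercive\<close> controls. Differences of values of \<open>B\<close> lie in that
  range, which is how they become comparable with the seminorm.\<close>

lemma inner_range_le:
  obtains p where "d \<bullet> Q w = p \<bullet> Q w" "\<nu> * (norm p)\<^sup>2 \<le> N d"
proof -
  obtain p where p: "p \<in> (ker Q)\<^sup>\<bottom>" "Q p = Q d" using ker_decomposition by blast
  have "d \<bullet> Q w = p \<bullet> Q w" using p(2) by (metis sym inner_commute)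
  then show ?thesis using that coercive[OF p(1)] N_cong[OF p(2)] by simp
qed

text \<open>The parallelogram law makes the upper limit midconvex with gap
  \<open>N (a - b) / 4\<close>, which \<open>coercive\<close> turns into a norm gap on
  \<open>(ker Q)\<^sup>\<bottom>\<close>; a minimizer there is a global one by
  \<open>N_cong\<close>. The quadratic growth term will later identify points up to
  \<open>ker Q\<close>.\<close>

lemma asymptotic_center:
  assumes F: "F \<noteq> bot" and bdd: "\<And>z. \<exists>M. eventually (\<lambda>k. N (y k - z) \<le> M) F"
  obtains c where "\<And>z. real_limsup F (\<lambda>k. N (y k - c)) + N (c - z) / 2
                        \<le> real_limsup F (\<lambda>k. N (y k - z))"
proof -
  define \<phi> where "\<phi> z = real_limsup F (\<lambda>k. N (y k - z))" for z
  have \<phi>_nonneg: "0 \<le> \<phi> z" for z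
  proof -
    obtain M where "eventually (\<lambda>k. N (y k - z) \<le> M) F" using bdd by blast
    from real_limsup_ge[of F 0 "\<lambda>k. N (y k - z)", OF F psd this] show ?thesis
      by (simp add: \<phi>_def)
  qed
  have comb: "\<phi> z \<le> p * \<phi> a + q * \<phi> b + r"
    if le: "\<And>k. N (y k - z) \<le> p * N (y k - a) + q * N (y k - b) + r" and pq: "0 \<le> p" "0 \<le> q"
    for z a b p q r
  proof -
    obtain M M' where M: "eventually (\<lambda>k. N (y k - a) \<le> M) F"
      and M': "eventually (\<lambda>k. N (y k - b) \<le> M') F"
      using bdd by blast
    show ?thesis unfolding \<phi>_def
      by (rule real_limsup_le_combination[OF F psd psd M psd M' pq always_eventually])
        (intro allI le)
  qed
  have mid: "\<phi> ((1/2) *\<^sub>R (a + b)) \<le> (\<phi> a + \<phi> b) / 2 - N (a - b) / 4" for a b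
  proof -
    have half: "N ((1/2) *\<^sub>R (p + q)) = 1/2 * N p + 1/2 * N q + - (N (q - p) / 4)" for p q
      unfolding N_scale N_add N_diff sym[of q p] by (simp add: power2_eq_square field_simps)
    have "N (y k - (1/2) *\<^sub>R (a + b))
        \<le> 1/2 * N (y k - a) + 1/2 * N (y k - b) + - (N (a - b) / 4)" for k
    proof -
      have "y k - (1/2) *\<^sub>R (a + b) = (1/2) *\<^sub>R ((y k - a) + (y k - b))"
        by (simp add: algebra_simps scaleR_2[symmetric])
      then show ?thesis using half[of "y k - a" "y k - b"] by simp
    qed
    from comb[OF this] show ?thesis by (simp add: add_divide_distrib)
  qed
  let ?V = "(ker Q)\<^sup>\<bottom>"
  have V: "subspace ?V" by (rule subspace_orthogonal_comp)
  obtain c where c: "c \<in> ?V" "\<And>z. z \<in> ?V \<Longrightarrow> \<phi> c \<le> \<phi> z"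
  proof (rule strongly_midconvex_minimizer[of ?V "\<nu> / 4" \<phi>])
    show "closed ?V"
    proof -
      have "?V = (\<Inter>y\<in>ker Q. {x. y \<bullet> x = 0})" by (auto simp: orthogonal_comp_def orthogonal_def)
      moreover have "closed {x. y \<bullet> x = 0}" for y :: 'a
        by (intro closed_Collect_eq continuous_intros)
      ultimately show ?thesis by auto
    qed
    show "?V \<noteq> {}" using V subspace_0 by blast
    show "\<nu> / 4 > 0" using \<nu> by simp
    show "bdd_below (\<phi> ` ?V)" using \<phi>_nonneg by (intro bdd_belowI[of _ 0]) auto
    show "(1/2) *\<^sub>R (a + b) \<in> ?V \<and> \<phi> ((1/2) *\<^sub>R (a + b)) \<le> (\<phi> a + \<phi> b) / 2 - \<nu> / 4 * (norm (a - b))\<^sup>2"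
      if "a \<in> ?V" "b \<in> ?V" for a b
    proof
      show "(1/2) *\<^sub>R (a + b) \<in> ?V" using that V by (intro subspace_scale subspace_add)
      have "\<nu> * (norm (a - b))\<^sup>2 \<le> N (a - b)" using that V by (intro coercive subspace_diff)
      then show "\<phi> ((1/2) *\<^sub>R (a + b)) \<le> (\<phi> a + \<phi> b) / 2 - \<nu> / 4 * (norm (a - b))\<^sup>2"
        using mid[of a b] by simp
    qed
    fix z c l
    assume z: "z \<longlonglongrightarrow> c" and l: "(\<lambda>n. \<phi> (z n)) \<longlonglongrightarrow> l"
    show "\<phi> c \<le> l"
    proof (rule le_if_le_scaled)
      fix \<epsilon> :: real assume \<epsilon>: "\<epsilon> > 0"
      \<comment> \<open>The summand with weight 0 is a dummy that fits the two-function form of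
        \<open>comb\<close>.\<close>
      have "\<phi> c \<le> (1 + \<epsilon>) * \<phi> (z n) + 0 * \<phi> c + (1 + 1 / \<epsilon>) * N (z n - c)" for n
        using N_add_le[OF \<epsilon>, of "y k - z n" "z n - c" for k] \<epsilon> by (intro comb) simp_all
      moreover have "(\<lambda>n. (1 + \<epsilon>) * \<phi> (z n) + 0 * \<phi> c + (1 + 1 / \<epsilon>) * N (z n - c))
          \<longlonglongrightarrow> (1 + \<epsilon>) * l + 0 * \<phi> c + (1 + 1 / \<epsilon>) * N (c - c)"
        by (intro tendsto_intros tendsto z l)
      ultimately have "\<phi> c \<le> (1 + \<epsilon>) * l + 0 * \<phi> c + (1 + 1 / \<epsilon>) * N (c - c)"
        by (intro LIMSEQ_le_const) auto
      then show "\<phi> c \<le> (1 + \<epsilon>) * l" by (simp add: zero)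
    qed
  qed blast
  have "\<phi> c + N (c - z) / 2 \<le> \<phi> z" for z
  proof -
    obtain p where p: "p \<in> ?V" "Q p = Q z" using ker_decomposition by blast
    have "N (y k - p) = N (y k - z)" for k using p by (intro N_cong) (simp add: diff)
    then have "\<phi> p = \<phi> z" by (simp add: \<phi>_def)
    moreover have "N (c - p) = N (c - z)" using p by (intro N_cong) (simp add: diff)
    \<comment> \<open>Bounding the midpoint value by \<open>mid\<close> and doubling turns the gap
      \<open>N (c - p) / 4\<close> into the growth term \<open>N (c - p) / 2\<close>.\<close>
    moreover have "\<phi> c \<le> \<phi> ((1/2) *\<^sub>R (c + p))"
      using c(1) p(1) V by (intro c(2) subspace_scale subspace_add)
    ultimately show ?thesis using mid[of c p] by argo
  qed
  then show ?thesis unfolding \<phi>_def by (rule that)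
qed

text \<open>Opial's lemma without weak compactness: the point \<open>s\<close> of \<open>Z\<close> with the smallest limit distance
  is an asymptotic center of the sequence along every finer filter, which forces weak convergence.\<close>

lemma weak_convergence:
  fixes x :: "nat \<Rightarrow> 'a"
  assumes lim: "\<And>s. s \<in> Z \<Longrightarrow> convergent (\<lambda>k. N (x k - s))" and "Z \<noteq> {}"
    and center: "\<And>F c. F \<noteq> bot \<Longrightarrow> F \<le> sequentially \<Longrightarrow>
      (\<And>z. real_limsup F (\<lambda>k. N (x k - c)) + N (c - z) / 2 \<le> real_limsup F (\<lambda>k. N (x k - z))) \<Longrightarrow>
      \<exists>s\<in>Z. real_limsup F (\<lambda>k. N (x k - s)) \<le> real_limsup F (\<lambda>k. N (x k - c))"
    and bdd: "\<And>z. \<exists>M. eventually (\<lambda>k. N (x k - z) \<le> M) sequentially"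
  obtains s where "s \<in> Z" "weakly_converges_to (\<lambda>k. Q (x k)) (Q s)"
proof -
  define \<phi> where "\<phi> F z = real_limsup F (\<lambda>k. N (x k - z))" for F z
  have \<phi>_Z: "\<phi> F s = lim (\<lambda>k. N (x k - s))" if "s \<in> Z" "F \<noteq> bot" "F \<le> sequentially" for F s
    unfolding \<phi>_def
    using real_limsup_eq_lim[of F 0 "\<lambda>k. N (x k - s)", OF that(2) psd]
      tendsto_mono[OF that(3)] lim[OF that(1)] convergent_LIMSEQ_iff by blast
  have min: "\<exists>s\<in>Z. \<forall>z. \<phi> F s \<le> \<phi> F z" if F: "F \<noteq> bot" "F \<le> sequentially" for F
  proof -
    have "\<exists>M. eventually (\<lambda>k. N (x k - z) \<le> M) F" for z
      using bdd F(2) by (meson filter_leD)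
    from asymptotic_center[OF F(1) this]
    obtain c where c: "\<And>z. \<phi> F c + N (c - z) / 2 \<le> \<phi> F z"
      unfolding \<phi>_def by blast
    then obtain s where s: "s \<in> Z" "\<phi> F s \<le> \<phi> F c"
      using center[OF F] unfolding \<phi>_def by blast
    have "\<phi> F c \<le> \<phi> F z" for z using c[of z] psd[of "c - z"] by linarith
    then show ?thesis using s order_trans by blast
  qed
  obtain s where s: "s \<in> Z" "\<And>z. \<phi> sequentially s \<le> \<phi> sequentially z"
    using min[of sequentially] by auto
  \<comment> \<open>Values at points of \<open>Z\<close> are limits of the whole sequence, hence the
    same for every \<open>F\<close>, and minimality along \<open>sequentially\<close> carries
    over.\<close>
  have s_min: "\<phi> F s \<le> \<phi> F z" if F: "F \<noteq> bot" "F \<le> sequentially" for F z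
  proof -
    obtain s' where s': "s' \<in> Z" "\<And>z. \<phi> F s' \<le> \<phi> F z" using min[OF F] by blast
    have "\<phi> F s = \<phi> sequentially s" using \<phi>_Z[OF s(1)] F by simp
    also have "\<dots> \<le> \<phi> sequentially s'" by (rule s(2))
    also have "\<dots> = \<phi> F s'" using \<phi>_Z[OF s'(1)] F by simp
    also have "\<dots> \<le> \<phi> F z" by (rule s'(2))
    finally show ?thesis .
  qed
  have upper: "eventually (\<lambda>k. Q (x k - s) \<bullet> u < \<delta>) sequentially" if \<delta>: "\<delta> > 0" for u \<delta>
  proof (rule ccontr)
    assume neg: "\<not> eventually (\<lambda>k. Q (x k - s) \<bullet> u < \<delta>) sequentially"
    \<comment> \<open>Restricting to the failing indices gives a proper filter, because they occur
      infinitely often; \<open>s_min\<close> applies to it.\<close>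
    define F where "F = inf sequentially (principal {k. \<delta> \<le> Q (x k - s) \<bullet> u})"
    have F: "F \<noteq> bot" "F \<le> sequentially"
      using neg by (auto simp: F_def trivial_limit_def eventually_inf_principal not_le)
    have ev: "eventually (\<lambda>k. \<delta> \<le> Q (x k - s) \<bullet> u) F"
      by (simp add: F_def eventually_inf_principal)
    \<comment> \<open>Small enough that \<open>t\<^sup>2 * N u - 2 * t * \<delta>\<close> is at most
      \<open>- t * \<delta>\<close>; the added 1 covers \<open>N u = 0\<close>.\<close>
    define t where "t = \<delta> / (N u + 1)"
    have t: "t > 0" "t * N u \<le> \<delta>"
      using \<delta> psd[of u] by (auto simp: t_def field_simps)
    obtain M where M: "eventually (\<lambda>k. N (x k - s) \<le> M) F" using bdd F(2) by (meson filter_leD)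
    have "\<phi> F (s + t *\<^sub>R u) \<le> 1 * \<phi> F s + 0 * \<phi> F s + (t\<^sup>2 * N u - 2 * t * \<delta>)"
      unfolding \<phi>_def
    proof (rule real_limsup_le_combination[OF F(1), where l = 0])
      show "eventually (\<lambda>k. N (x k - (s + t *\<^sub>R u))
          \<le> 1 * N (x k - s) + 0 * N (x k - s) + (t\<^sup>2 * N u - 2 * t * \<delta>)) F"
        using ev
      proof eventually_elim
        case (elim k)
        have "N (x k - (s + t *\<^sub>R u)) = N (x k - s - t *\<^sub>R u)" by (simp add: diff_diff_eq)
        also have "\<dots> = N (x k - s) - 2 * t * (Q (x k - s) \<bullet> u) + t\<^sup>2 * N u"
          by (simp only: N_diff[of "x k - s"] N_scale) simp
        finally show ?case using mult_left_mono[OF elim, of "2 * t"] t by simp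
      qed
    qed (use psd M in auto)
    moreover have "t\<^sup>2 * N u \<le> t * \<delta>" using t by (simp add: power2_eq_square mult_left_mono)
    moreover have "0 < t * \<delta>" using t \<delta> by simp
    ultimately show False using s_min[OF F, of "s + t *\<^sub>R u"] by linarith
  qed
  have "(\<lambda>k. Q (x k) \<bullet> u) \<longlonglongrightarrow> Q s \<bullet> u" for u
  proof (rule LIMSEQ_I)
    fix e :: real assume e: "e > 0"
    have "eventually (\<lambda>k. norm (Q (x k) \<bullet> u - Q s \<bullet> u) < e) sequentially"
      using upper[OF e, of u] upper[OF e, of "- u"]
      by eventually_elim (simp add: diff inner_diff_left)
    then show "\<exists>no. \<forall>n\<ge>no. norm (Q (x n) \<bullet> u - Q s \<bullet> u) < e"
      by (simp add: eventually_sequentially)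
  qed
  then show ?thesis using that s(1) by (auto simp: weakly_converges_to_def)
qed

end

section \<open>The preconditioned forward-backward iteration\<close>

locale preconditioned_splitting = degenerate_preconditioner Q \<nu>
  for Q :: "'a::{real_inner, complete_space} \<Rightarrow> 'a" and \<nu> +
  fixes A :: "'a \<Rightarrow> 'a set" and B :: "'a \<Rightarrow> 'a" and \<beta> :: real
  assumes mono: "monotone_operator A"
    and \<beta>: "0 \<le> \<beta>" and coco: "inverse_cocoercive \<beta> B"
    and ranB: "range B \<subseteq> range Q"
begin

lemma forward_backward_iff: "u \<in> forward_backward A Q B z \<longleftrightarrow> Q z - B z - Q u \<in> A u"
proof -
  have "Q z - B z = a + Q u \<longleftrightarrow> a = Q z - B z - Q u" for a by auto
  then show ?thesis
    by (simp add: forward_backward_def inverse_operator_def sum_operator_def image_iff)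
qed

lemma zer_iff: "s \<in> zer (sum_operator A B) \<longleftrightarrow> - B s \<in> A s"
proof -
  have "0 = a + B s \<longleftrightarrow> a = - B s" for a by (auto simp: eq_neg_iff_add_eq_0)
  then show ?thesis by (simp add: zer_def sum_operator_def image_iff)
qed

lemma zer_fixed: "s \<in> zer (sum_operator A B) \<Longrightarrow> s \<in> forward_backward A Q B s"
  by (simp add: zer_iff forward_backward_iff)

lemma B_diff_range:
  obtains w where "B y - B z = Q w"
proof -
  obtain a b where "B y = Q a" "B z = Q b" using ranB by blast
  then have "B y - B z = Q (a - b)" by (simp add: diff)
  then show ?thesis using that by blast
qed

text \<open>\<open>B y - B z\<close> lies in the range of \<open>Q\<close> and is therefore
  orthogonal to \<open>y - z\<close>, a kernel element; cocoercivity then makes it vanish.\<close>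

lemma B_cong:
  assumes "Q y = Q z"
  shows "B y = B z"
proof (cases "\<beta> = 0")
  case True
  then show ?thesis using coco by (simp add: inverse_cocoercive_def)
next
  case False
  obtain w where w: "B y - B z = Q w" using B_diff_range by blast
  have "(y - z) \<bullet> (B y - B z) = 0"
    using sym[of w "y - z"] assms by (simp add: w inner_commute diff)
  moreover have "inverse \<beta> * (norm (B y - B z))\<^sup>2 \<le> (y - z) \<bullet> (B y - B z)"
    using coco False by (simp add: inverse_cocoercive_def)
  ultimately have "(norm (B y - B z))\<^sup>2 \<le> 0"
    using False \<beta> by (simp add: field_simps mult_le_0_iff)
  then show ?thesis by simp
qed

text \<open>After \<open>inner_range_le\<close> replaces \<open>d\<close> by \<open>p\<close>,
  complete the square in \<open>norm (B y - B z)\<close>: cocoercivity pays for the cross term up to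
  \<open>\<beta> / 4 * (norm p)\<^sup>2\<close>.\<close>

lemma B_diff_lower_bound:
  "- (\<beta> / (4 * \<nu>)) * N d \<le> (y - z) \<bullet> (B y - B z) - d \<bullet> (B y - B z)"
proof (cases "\<beta> = 0")
  case True
  then show ?thesis using coco by (simp add: inverse_cocoercive_def)
next
  case False
  then have \<beta>_pos: "\<beta> > 0" using \<beta> by simp
  define b where "b = norm (B y - B z)"
  obtain w where w: "B y - B z = Q w" using B_diff_range by blast
  obtain p where p: "d \<bullet> Q w = p \<bullet> Q w" "\<nu> * (norm p)\<^sup>2 \<le> N d" using inner_range_le by blast
  have "d \<bullet> (B y - B z) \<le> norm p * b"
    using norm_cauchy_schwarz[of p "Q w"] by (simp add: w p(1) b_def)
  moreover have "inverse \<beta> * b\<^sup>2 \<le> (y - z) \<bullet> (B y - B z)"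
    using coco False by (simp add: inverse_cocoercive_def b_def)
  moreover have "inverse \<beta> * b\<^sup>2 - norm p * b + \<beta> / 4 * (norm p)\<^sup>2
      = inverse \<beta> * (b - \<beta> / 2 * norm p)\<^sup>2"
    using False by (simp add: power2_eq_square field_simps)
  moreover have "0 \<le> inverse \<beta> * (b - \<beta> / 2 * norm p)\<^sup>2" using \<beta> by simp
  moreover have "\<beta> / 4 * (norm p)\<^sup>2 \<le> \<beta> / (4 * \<nu>) * N d"
    using mult_left_mono[OF p(2), of "\<beta> / (4 * \<nu>)"] \<beta> \<nu> by simp
  ultimately show ?thesis by linarith
qed

text \<open>Monotonicity of \<open>A\<close> at \<open>u\<close> and \<open>v\<close>, with the
  \<open>B\<close> terms absorbed by \<open>B_diff_lower_bound\<close>, bounds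
  \<open>Q d \<bullet> (u - v)\<close> from below; this is the cross term of
  \<open>N (d + (u - v))\<close>. Arbitrary selections \<open>u\<close> and \<open>v\<close> are
  allowed.\<close>

lemma forward_backward_averaged:
  assumes "u \<in> forward_backward A Q B y" "v \<in> forward_backward A Q B z"
  shows "N (u - v) \<le> N (y - z) - (1 - \<beta> / (2 * \<nu>)) * N ((y - u) - (z - v))"
proof -
  define d where "d = (y - u) - (z - v)"
  have Qd: "Q d = Q y - Q u - (Q z - Q v)" by (simp add: d_def diff)
  have "0 \<le> (u - v) \<bullet> ((Q y - B y - Q u) - (Q z - B z - Q v))"
    using mono assms by (auto simp: monotone_operator_def forward_backward_iff)
  also have "\<dots> = Q d \<bullet> (u - v) - (u - v) \<bullet> (B y - B z)"
    by (simp add: Qd inner_diff_right inner_commute)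
  also have "(u - v) \<bullet> (B y - B z) = (y - z) \<bullet> (B y - B z) - d \<bullet> (B y - B z)"
    by (simp add: d_def algebra_simps)
  finally have "- (\<beta> / (4 * \<nu>)) * N d \<le> Q d \<bullet> (u - v)"
    using B_diff_lower_bound[of d y z] by linarith
  moreover have "N (y - z) = N d + 2 * (Q d \<bullet> (u - v)) + N (u - v)"
    using N_add[of d "u - v"] by (simp add: d_def algebra_simps)
  moreover have "(1 - \<beta> / (2 * \<nu>)) * N d = N d + 2 * (- (\<beta> / (4 * \<nu>)) * N d)"
    by (simp add: algebra_simps)
  ultimately show ?thesis unfolding d_def[symmetric] by linarith
qed

text \<open>The averaged estimate is a lower bound on \<open>Q e \<bullet> d\<close>, which is the
  linear term when \<open>N (e - \<gamma> *\<^sub>R d)\<close> is expanded in \<gamma>.\<close>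

lemma relaxed_step:
  assumes "u \<in> forward_backward A Q B y" "v \<in> forward_backward A Q B z" "0 < \<gamma>"
  shows "N ((y + \<gamma> *\<^sub>R (u - y)) - (z + \<gamma> *\<^sub>R (v - z)))
    \<le> N (y - z) - \<gamma> * (2 - \<beta> / (2 * \<nu>) - \<gamma>) * N ((y - u) - (z - v))"
proof -
  define e d where "e = y - z" and "d = (y - u) - (z - v)"
  have eq: "(y + \<gamma> *\<^sub>R (u - y)) - (z + \<gamma> *\<^sub>R (v - z)) = e - \<gamma> *\<^sub>R d"
    by (simp add: e_def d_def algebra_simps)
  have "u - v = e - d" by (simp add: e_def d_def)
  then have "N (e - d) \<le> N e - (1 - \<beta> / (2 * \<nu>)) * N d"
    using forward_backward_averaged[OF assms(1,2)] by (simp add: e_def d_def)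
  then have "2 * (Q e \<bullet> d) \<ge> (2 - \<beta> / (2 * \<nu>)) * N d"
    unfolding N_diff left_diff_distrib by linarith
  then have "\<gamma> * (2 * (Q e \<bullet> d)) \<ge> \<gamma> * ((2 - \<beta> / (2 * \<nu>)) * N d)"
    using assms(3) by (intro mult_left_mono) auto
  moreover have "N (e - \<gamma> *\<^sub>R d) = N e - \<gamma> * (2 * (Q e \<bullet> d)) + \<gamma>\<^sup>2 * N d"
    by (simp only: N_diff[of e] N_scale) simp
  ultimately have "N (e - \<gamma> *\<^sub>R d) \<le> N e - \<gamma> * (2 - \<beta> / (2 * \<nu>) - \<gamma>) * N d"
    by (simp add: left_diff_distrib right_diff_distrib power2_eq_square)
  then show ?thesis by (simp only: eq e_def[symmetric] d_def[symmetric])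
qed

text \<open>A fixed point modulo \<open>ker Q\<close> suffices: \<open>B u = B c\<close> by
  \<open>B_cong\<close>, so the inclusion at \<open>u\<close> loses its \<open>Q\<close> terms. The
  zero is the image \<open>u\<close>, not \<open>c\<close>.\<close>

lemma fixed_imp_zer:
  assumes "u \<in> forward_backward A Q B c" "Q u = Q c"
  shows "u \<in> zer (sum_operator A B)"
  using assms B_cong[OF assms(2)] by (simp add: zer_iff forward_backward_iff)

end

section \<open>Fejer monotonicity, rate and weak limit of the relaxed iteration\<close>

locale relaxed_iteration = preconditioned_splitting Q \<nu> A B \<beta>
  for Q :: "'a::{real_inner, complete_space} \<Rightarrow> 'a" and \<nu> A B \<beta> +
  fixes T :: "'a \<Rightarrow> 'a" and x :: "nat \<Rightarrow> 'a" and \<gamma> :: real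
  assumes T: "\<And>z. T z \<in> forward_backward A Q B z"
    and x_Suc: "\<And>k. x (Suc k) = x k + \<gamma> *\<^sub>R (T (x k) - x k)"
    and \<beta>\<nu>: "\<beta> / 2 < \<nu>"
    and \<gamma>: "0 < \<gamma>" "\<gamma> < 2 - \<beta> / (2 * \<nu>)"
begin

text \<open>The gain in \<open>relaxed_step\<close> divided by \<open>\<gamma>\<^sup>2\<close>, so
  that it multiplies the actual step instead of the residual; \<open>1 / \<rho>\<close> is the
  constant under the root in the rate.\<close>

definition \<rho> :: real where "\<rho> = (2 - \<beta> / (2 * \<nu>) - \<gamma>) / \<gamma>"

lemma \<rho>_pos: "0 < \<rho>"
  using \<gamma> by (simp add: \<rho>_def)

lemma N_step: "N (x (Suc k) - x k) = \<gamma>\<^sup>2 * N (x k - T (x k))"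
  using N_scale[of \<gamma> "T (x k) - x k"] by (simp add: x_Suc N_minus_commute)

text \<open>\<open>relaxed_step\<close> with \<open>z = v = s\<close>; by \<open>zer_fixed\<close>
  this selection is legitimate even if \<open>T s\<close> differs from \<open>s\<close>.\<close>

lemma fejer:
  assumes "s \<in> zer (sum_operator A B)"
  shows "N (x (Suc k) - s) + \<rho> * N (x (Suc k) - x k) \<le> N (x k - s)"
proof -
  have "N (x (Suc k) - s) \<le> N (x k - s) - \<gamma> * (2 - \<beta> / (2 * \<nu>) - \<gamma>) * N (x k - T (x k))"
    using relaxed_step[OF T zer_fixed[OF assms] \<gamma>(1), of "x k"] by (simp add: x_Suc)
  moreover have "\<rho> * \<gamma>\<^sup>2 = \<gamma> * (2 - \<beta> / (2 * \<nu>) - \<gamma>)"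
    using \<gamma>(1) by (simp add: \<rho>_def power2_eq_square)
  then have "\<rho> * N (x (Suc k) - x k) = \<gamma> * (2 - \<beta> / (2 * \<nu>) - \<gamma>) * N (x k - T (x k))"
    by (simp only: N_step mult.assoc[symmetric])
  ultimately show ?thesis by linarith
qed

text \<open>\<open>relaxed_step\<close> applied to two consecutive iterates, with the nonnegative
  gain dropped.\<close>

lemma step_decreasing: "decseq (\<lambda>k. N (x (Suc k) - x k))"
proof (rule decseq_SucI)
  fix k
  have "0 \<le> \<gamma> * (2 - \<beta> / (2 * \<nu>) - \<gamma>) * N ((x (Suc k) - T (x (Suc k))) - (x k - T (x k)))"
    using \<gamma> psd by (intro mult_nonneg_nonneg) auto
  then show "N (x (Suc (Suc k)) - x (Suc k)) \<le> N (x (Suc k) - x k)"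
    using relaxed_step[OF T T \<gamma>(1), of "x (Suc k)" "x k"]
    by (simp only: x_Suc[of k, symmetric] x_Suc[of "Suc k", symmetric])
qed

text \<open>\<open>fejer\<close> telescopes over the first \<open>Suc k\<close> steps, and the last
  of these, being the smallest, is at most their mean.\<close>

lemma step_bound:
  assumes "s \<in> zer (sum_operator A B)"
  shows "\<rho> * real (Suc k) * N (x (Suc k) - x k) \<le> N (x 0 - s)"
proof -
  have sum: "N (x n - s) + \<rho> * (\<Sum>j<n. N (x (Suc j) - x j)) \<le> N (x 0 - s)" for n
  proof (induction n)
    case (Suc n)
    then show ?case using fejer[OF assms, of n] by (simp add: distrib_left)
  qed simp
  have "real (Suc k) * N (x (Suc k) - x k) = (\<Sum>j<Suc k. N (x (Suc k) - x k))" by simp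
  also have "\<dots> \<le> (\<Sum>j<Suc k. N (x (Suc j) - x j))"
    using decseqD[OF step_decreasing] by (intro sum_mono) auto
  finally have "\<rho> * (real (Suc k) * N (x (Suc k) - x k)) \<le> \<rho> * (\<Sum>j<Suc k. N (x (Suc j) - x j))"
    using \<rho>_pos by (intro mult_left_mono) auto
  then show ?thesis using sum[of "Suc k"] psd[of "x (Suc k) - s"] by (simp add: mult.assoc)
qed

lemma convergence_rate:
  assumes "s \<in> zer (sum_operator A B)"
  shows "Q_seminorm Q (x (Suc k) - x k)
    \<le> 1 / sqrt (real k + 1) * sqrt (2 * \<gamma> * \<nu> / ((4 - 2 * \<gamma>) * \<nu> - \<beta>)) * Q_seminorm Q (x 0 - s)"
proof -
  have "\<rho> = ((4 - 2 * \<gamma>) * \<nu> - \<beta>) / (2 * \<gamma> * \<nu>)"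
    using \<nu> \<gamma>(1) by (simp add: \<rho>_def field_simps)
  then have \<rho>: "2 * \<gamma> * \<nu> / ((4 - 2 * \<gamma>) * \<nu> - \<beta>) = 1 / \<rho>" by simp
  have "N (x (Suc k) - x k) \<le> 1 / (real k + 1) * (1 / \<rho>) * N (x 0 - s)"
    using step_bound[OF assms, of k] \<rho>_pos
    by (simp add: pos_le_divide_eq mult_ac add.commute)
  then have "sqrt (N (x (Suc k) - x k)) \<le> sqrt (1 / (real k + 1) * (1 / \<rho>) * N (x 0 - s))"
    by (rule real_sqrt_le_mono)
  then show ?thesis unfolding \<rho> Q_seminorm_def by (simp add: real_sqrt_mult real_sqrt_divide)
qed

lemma zer_convergent:
  assumes "s \<in> zer (sum_operator A B)"
  shows "convergent (\<lambda>k. N (x k - s))"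
proof -
  have "decseq (\<lambda>k. N (x k - s))"
  proof (rule decseq_SucI)
    fix k
    have "0 \<le> \<rho> * N (x (Suc k) - x k)" using \<rho>_pos psd by simp
    then show "N (x (Suc k) - s) \<le> N (x k - s)" using fejer[OF assms, of k] by linarith
  qed
  then obtain L where "(\<lambda>k. N (x k - s)) \<longlonglongrightarrow> L"
    using decseq_convergent[of "\<lambda>k. N (x k - s)" 0] psd by blast
  then show ?thesis by (rule convergentI)
qed

lemma residual_tendsto_0:
  assumes "s \<in> zer (sum_operator A B)"
  shows "(\<lambda>k. N (x k - T (x k))) \<longlonglongrightarrow> 0"
proof (rule tendsto_sandwich[of "\<lambda>_. 0"])
  have "N (x k - T (x k)) \<le> N (x 0 - s) / (\<rho> * \<gamma>\<^sup>2) * (1 / real (Suc k))" for k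
    using step_bound[OF assms, of k] \<rho>_pos \<gamma>(1) unfolding N_step by (simp add: field_simps del: of_nat_Suc)
  then show "eventually (\<lambda>k. N (x k - T (x k)) \<le> N (x 0 - s) / (\<rho> * \<gamma>\<^sup>2) * (1 / real (Suc k))) sequentially"
    by simp
  show "(\<lambda>k. N (x 0 - s) / (\<rho> * \<gamma>\<^sup>2) * (1 / real (Suc k))) \<longlonglongrightarrow> 0"
    by (rule tendsto_mult_right_zero[OF LIMSEQ_Suc[OF lim_1_over_n]])
qed (use psd in auto)

lemma T_nonexpansive: "N (T y - T z) \<le> N (y - z)"
proof -
  have "0 \<le> (1 - \<beta> / (2 * \<nu>)) * N ((y - T y) - (z - T z))"
    using \<beta>\<nu> \<nu> psd by (intro mult_nonneg_nonneg) (auto simp: field_simps)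
  then show ?thesis using forward_backward_averaged[OF T T, of y z] by linarith
qed

lemma eventually_bounded:
  assumes "s \<in> zer (sum_operator A B)"
  shows "\<exists>M. eventually (\<lambda>k. N (x k - z) \<le> M) sequentially"
proof -
  have "Bseq (\<lambda>k. N (x k - s))" by (rule convergent_imp_Bseq[OF zer_convergent[OF assms]])
  then obtain K where K: "\<And>k. norm (N (x k - s)) \<le> K" by (auto simp: Bseq_def)
  have "N (x k - z) \<le> 2 * K + 2 * N (s - z)" for k
    using N_add_le[of 1 "x k - s" "s - z"] K[of k] by simp
  then show ?thesis by (intro exI always_eventually) blast
qed

text \<open>The asymptotic center replaces the demiclosedness principle.\<close>

lemma T_asymptotic_center:
  assumes s: "s \<in> zer (sum_operator A B)" and F: "F \<noteq> bot" "F \<le> sequentially"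
    and c: "\<And>z. real_limsup F (\<lambda>k. N (x k - c)) + N (c - z) / 2 \<le> real_limsup F (\<lambda>k. N (x k - z))"
  shows "T c \<in> zer (sum_operator A B)"
    and "real_limsup F (\<lambda>k. N (x k - T c)) \<le> real_limsup F (\<lambda>k. N (x k - c))"
proof -
  let ?\<phi> = "\<lambda>z. real_limsup F (\<lambda>k. N (x k - z))"
  define e where "e k = N (x k - T (x k))" for k
  have e: "(e \<longlongrightarrow> 0) F"
    using tendsto_mono[OF F(2) residual_tendsto_0[OF s]] by (simp add: e_def[abs_def])
  have e0: "real_limsup F e = 0"
    by (rule real_limsup_eq_lim[of F 0 e, OF F(1) _ e]) (use psd in \<open>simp add: e_def\<close>)
  obtain M where M: "eventually (\<lambda>k. N (x k - c) \<le> M) F"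
    using eventually_bounded[OF s] F(2) by (meson filter_leD)
  have M': "eventually (\<lambda>k. e k \<le> 1) F"
    using order_tendstoD(2)[OF e, of 1] by (auto elim: eventually_mono)
  \<comment> \<open>The residual vanishes along \<open>F\<close>, so \<open>x k\<close> may be
    replaced by \<open>T (x k)\<close> at no cost in the limit, and \<open>T\<close> is
    nonexpansive.\<close>
  show le_c: "?\<phi> (T c) \<le> ?\<phi> c"
  proof (rule le_if_le_scaled)
    fix \<epsilon> :: real assume \<epsilon>: "\<epsilon> > 0"
    have "N (x k - T c) \<le> (1 + \<epsilon>) * N (x k - c) + (1 + 1 / \<epsilon>) * e k + 0" for k
    proof -
      have "N (x k - T c) \<le> (1 + \<epsilon>) * N (T (x k) - T c) + (1 + 1 / \<epsilon>) * e k"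
        using N_add_le[OF \<epsilon>, of "T (x k) - T c" "x k - T (x k)"] by (simp add: e_def)
      also have "(1 + \<epsilon>) * N (T (x k) - T c) \<le> (1 + \<epsilon>) * N (x k - c)"
        using \<epsilon> T_nonexpansive by (intro mult_left_mono) auto
      finally show ?thesis by simp
    qed
    then have "?\<phi> (T c) \<le> (1 + \<epsilon>) * ?\<phi> c + (1 + 1 / \<epsilon>) * real_limsup F e + 0"
      using \<epsilon>
      by (intro real_limsup_le_combination[OF F(1) psd psd M _ M' _ _ always_eventually])
        (simp_all add: e_def psd)
    then show "?\<phi> (T c) \<le> (1 + \<epsilon>) * ?\<phi> c" by (simp add: e0)
  qed
  \<comment> \<open>The growth term at \<open>T c\<close> is squeezed out: the upper limit at
    \<open>c\<close> plus \<open>N (c - T c) / 2\<close> is at most that at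
    \<open>c\<close>.\<close>
  then have "N (c - T c) = 0" using c[of "T c"] psd[of "c - T c"] by linarith
  then have "Q (T c) = Q c" using N_eq_0D[of "c - T c"] by (simp add: diff)
  then show "T c \<in> zer (sum_operator A B)" by (rule fixed_imp_zer[OF T])
qed

lemma weak_limit:
  assumes "zer (sum_operator A B) \<noteq> {}"
  shows "\<exists>s\<in>zer (sum_operator A B). weakly_converges_to (\<lambda>k. Q (x k)) (Q s)"
proof -
  obtain s where s: "s \<in> zer (sum_operator A B)" using assms by blast
  have "\<exists>t\<in>zer (sum_operator A B).
      real_limsup F (\<lambda>k. N (x k - t)) \<le> real_limsup F (\<lambda>k. N (x k - c))"
    if "F \<noteq> bot" "F \<le> sequentially"
      "\<And>z. real_limsup F (\<lambda>k. N (x k - c)) + N (c - z) / 2 \<le> real_limsup F (\<lambda>k. N (x k - z))" for F c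
    by (rule bexI[of _ "T c"]) (rule T_asymptotic_center[OF s that])+
  from weak_convergence[OF zer_convergent assms this eventually_bounded[OF s]] show ?thesis
    by blast
qed

end

theorem corollary4p1:
  fixes A :: "'a::{real_inner, complete_space} \<Rightarrow> 'a set"
    and Q B T :: "'a \<Rightarrow> 'a"
    and x :: "nat \<Rightarrow> 'a"
    and \<beta> \<nu> \<gamma> :: real
  assumes "maximally_monotone A"
    and "bounded_linear Q" and "self_adjoint Q"
    and "degenerate Q"
    and "closed (range Q)"
    and "0 \<le> \<beta>" and "inverse_cocoercive \<beta> B"
    and "range B \<subseteq> range Q"
    and "range (\<lambda>z. Q z - B z) \<subseteq> range_operator (sum_operator A Q)"
    and "zer (sum_operator A B) \<noteq> {}"
    and "0 < \<nu>" and "\<And>z. z \<in> (ker Q)\<^sup>\<bottom> \<Longrightarrow> \<nu> * norm z \<le> norm (Q z)"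
    and "\<And>z. T z \<in> forward_backward A Q B z"
    and "\<And>k. x (Suc k) = x k + \<gamma> *\<^sub>R (T (x k) - x k)"
    and "\<beta> / 2 < \<nu>"
    and "0 < \<gamma>" and "\<gamma> < 2 - \<beta> / (2 * \<nu>)"
  shows "(\<exists>xs \<in> zer (sum_operator A B). weakly_converges_to (\<lambda>k. Q (x k)) (Q xs)) \<and>
         (\<forall>xs \<in> zer (sum_operator A B). \<forall>k.
            Q_seminorm Q (x (Suc k) - x k)
              \<le> 1 / sqrt (real k + 1)
                 * sqrt (2 * \<gamma> * \<nu> / ((4 - 2 * \<gamma>) * \<nu> - \<beta>))
                 * Q_seminorm Q (x 0 - xs))"
proof -
  interpret bounded_linear Q by (rule assms(2))
  interpret relaxed_iteration Q \<nu> A B \<beta> T x \<gamma>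
  proof
    show "0 \<le> Q z \<bullet> z" for z using assms(4) by (simp add: degenerate_def)
    show "monotone_operator A" using assms(1) by (simp add: maximally_monotone_def)
  qed (fact assms)+
  show ?thesis by (intro conjI ballI allI weak_limit assms(10) convergence_rate)
qed

end
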